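(* Let $(c_n)\in\ell^2_{\mathbb{R}}$ and let $t\mapsto (p_n)(t)$ be a gradient flow line of $F_{(c_n)}$ on $(\Delta,\mathcal{G}^{\mathrm{FR}})$ with initial value $(p_n)(0)=(p_n)_0\in\Delta$. Then, for all $n\in\mathbb{N}$ and $t\in[0,\infty)$, the components of $(p_n)(t)$ are given by $$p_n(t)=\frac{p_n(0)\,e^{c_nt}}{\sum_{k=0}^\infty p_k(0)\,e^{c_kt}}.$$ If in addition the sequence $(c_n)$ is strictly monotonically decreasing, then the limit $p_{\max}:=\lim_{t\to\infty}(p_n)(t)$ exists and is a solution of the linear programming problem $$\max_{(p_n)\in\bar\Delta}\ \langle (c_n),(p_n)\rangle_{\ell^2}.$$
   Context: Sequences are indexed by $n\in\mathbb{N}=\{0,1,2,\dots\}$. $\ell^2_{\mathbb{R}}$ is the Hilbert space of real square-summable sequences with $\langle (x_n),(y_n)\rangle_{\ell^2}=\sum_{n=0}^\infty x_ny_n$. The $\ell^2$-probability simplex is $\Delta=\{(p_n)\in\ell^1_{\mathbb{R}}:\sum_{n=0}^\infty p_n=1,\ p_n>0\ \forall n\in\mathbb{N}\}$. Its differentiable structure is the one for which the square-root map $(p_n)\mapsto(\sqrt{p_n})$ is a diffeomorphism onto $\mathcal{U}=\{(x_n)\in\ell^2_{\mathbb{R}}:\sum_{n=0}^\infty x_n^2=1,\ x_n>0\ \forall n\in\mathbb{N}\}$, regarded as an open subset of the unit sphere of $\ell^2_{\mathbb{R}}$. The tangent spaces are $T_{(p_n)}\Delta=\{(v_n)\in\ell^1_{\mathbb{R}}:\sum_{n=0}^\infty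 v_n=0,\ (v_n/\sqrt{p_n})\in\ell^2_{\mathbb{R}}\}$, and the $\ell^2$-Fisher–Rao metric is $\mathcal{G}^{\mathrm{FR}}_{(p_n)}((v_n),(w_n))=\frac14\sum_{n=0}^\infty\frac{v_nw_n}{p_n}$. $\bar\Delta$ denotes the closure of $\Delta$, corresponding under the square-root map to the closure of $\mathcal{U}$ in the unit sphere of $\ell^2_{\mathbb{R}}$: $\bar\Delta=\{(p_n)\in\ell^1_{\mathbb{R}}:\sum_{n=0}^\infty p_n=1,\ p_n\ge0\ \forall n\in\mathbb{N}\}$, with limits taken in the corresponding topology (the $\ell^1$ topology). For $(c_n)\in\ell^2_{\mathbb{R}}$, $F_{(c_n)}:\Delta\to\mathbb{R}$ is the smooth function $F_{(c_n)}((p_n))=\langle (c_n),(p_n)\rangle_{\ell^2}$. A gradient flow line of $F_{(c_n)}$ is an integral curve in $\Delta$ of the gradient vector field of $F_{(c_n)}$ with respect to $\mathcal{G}^{\mathrm{FR}}$.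
   Formalization: The exponents c_n t and c_k t in the formula are corrected to 4c_n t and 4c_k t, since the factor 1/4 in the Fisher–Rao metric makes the gradient 4p_n(c_n − F(p)); the printed formula fails for every nonzero (c_n). *)

theory Defs
  imports "HOL-Analysis.Analysis"
begin

section \<open>The real Hilbert space of square-summable sequences\<close>

typedef ell2 = "{x :: nat \<Rightarrow> real. summable (\<lambda>n. (x n)\<^sup>2)}"
  morphisms ell2_nth Ell2
  by (rule exI[of _ "\<lambda>_. 0"]) simp

lemma ell2_nth_square_summable [simp]: "summable (\<lambda>n. (ell2_nth x n)\<^sup>2)"
  using ell2_nth[of x] by simp

lemma ell2_nth_Ell2 [simp]: "summable (\<lambda>n. (x n)\<^sup>2) \<Longrightarrow> ell2_nth (Ell2 x) = x"
  by (simp add: Ell2_inverse)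

lemma ell2_eqI: "(\<And>n. ell2_nth x n = ell2_nth y n) \<Longrightarrow> x = y"
  by (metis ell2_nth_inject ext)

lemma square_summable_mult:
  fixes x y :: "nat \<Rightarrow> real"
  assumes "summable (\<lambda>n. (x n)\<^sup>2)" "summable (\<lambda>n. (y n)\<^sup>2)"
  shows "summable (\<lambda>n. x n * y n)"
proof (rule summable_comparison_test'[where N = 0])
  show "summable (\<lambda>n. (x n)\<^sup>2 + (y n)\<^sup>2)"
    using assms by (rule summable_add)
  show "norm (x n * y n) \<le> (x n)\<^sup>2 + (y n)\<^sup>2" for n
  proof -
    have "0 \<le> (\<bar>x n\<bar> - \<bar>y n\<bar>)\<^sup>2"
      by simp
    then have "2 * \<bar>x n * y n\<bar> \<le> (x n)\<^sup>2 + (y n)\<^sup>2"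
      by (simp add: power2_diff abs_mult)
    then show ?thesis
      by simp
  qed
qed

lemma square_summable_add:
  fixes x y :: "nat \<Rightarrow> real"
  assumes "summable (\<lambda>n. (x n)\<^sup>2)" "summable (\<lambda>n. (y n)\<^sup>2)"
  shows "summable (\<lambda>n. (x n + y n)\<^sup>2)"
proof -
  have "summable (\<lambda>n. (x n)\<^sup>2 + (y n)\<^sup>2 + 2 * (x n * y n))"
    using assms square_summable_mult[OF assms]
    by (intro summable_add summable_mult)
  then show ?thesis
    by (simp add: power2_sum mult.assoc)
qed

lemma square_summable_cmult:
  fixes x :: "nat \<Rightarrow> real"
  assumes "summable (\<lambda>n. (x n)\<^sup>2)"
  shows "summable (\<lambda>n. (a * x n)\<^sup>2)"
  using summable_mult[OF assms, of "a\<^sup>2"] by (simp add: power_mult_distrib)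

lemma ell2_mult_summable [simp]: "summable (\<lambda>n. ell2_nth x n * ell2_nth y n)"
  by (rule square_summable_mult) simp_all

instantiation ell2 :: real_inner
begin

definition zero_ell2 :: ell2 where "zero_ell2 = Ell2 (\<lambda>_. 0)"

definition uminus_ell2 :: "ell2 \<Rightarrow> ell2" where
  "uminus_ell2 x = Ell2 (\<lambda>n. - ell2_nth x n)"

definition plus_ell2 :: "ell2 \<Rightarrow> ell2 \<Rightarrow> ell2" where
  "plus_ell2 x y = Ell2 (\<lambda>n. ell2_nth x n + ell2_nth y n)"

definition minus_ell2 :: "ell2 \<Rightarrow> ell2 \<Rightarrow> ell2" where
  "minus_ell2 x y = Ell2 (\<lambda>n. ell2_nth x n - ell2_nth y n)"

definition scaleR_ell2 :: "real \<Rightarrow> ell2 \<Rightarrow> ell2" where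
  "scaleR_ell2 a x = Ell2 (\<lambda>n. a * ell2_nth x n)"

definition inner_ell2 :: "ell2 \<Rightarrow> ell2 \<Rightarrow> real" where
  "inner_ell2 x y = (\<Sum>n. ell2_nth x n * ell2_nth y n)"

definition norm_ell2 :: "ell2 \<Rightarrow> real" where
  "norm_ell2 x = sqrt (x \<bullet> x)"

definition sgn_ell2 :: "ell2 \<Rightarrow> ell2" where
  "sgn_ell2 x = inverse (norm x) *\<^sub>R x"

definition dist_ell2 :: "ell2 \<Rightarrow> ell2 \<Rightarrow> real" where
  "dist_ell2 x y = norm (x - y)"

definition uniformity_ell2 :: "(ell2 \<times> ell2) filter" where
  "uniformity_ell2 = (INF e\<in>{0<..}. principal {(x, y). dist x y < e})"

definition open_ell2 :: "ell2 set \<Rightarrow> bool" where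
  "open_ell2 U = (\<forall>x\<in>U. \<forall>\<^sub>F (x', y) in uniformity. x' = x \<longrightarrow> y \<in> U)"

lemma ell2_nth_zero [simp]: "ell2_nth 0 n = 0"
  by (simp add: zero_ell2_def)

lemma ell2_nth_add [simp]: "ell2_nth (x + y) n = ell2_nth x n + ell2_nth y n"
  by (simp add: plus_ell2_def square_summable_add)

lemma ell2_nth_uminus [simp]: "ell2_nth (- x) n = - ell2_nth x n"
  by (simp add: uminus_ell2_def)

lemma ell2_nth_diff [simp]: "ell2_nth (x - y) n = ell2_nth x n - ell2_nth y n"
  using square_summable_add[of "ell2_nth x" "\<lambda>n. - ell2_nth y n"]
  by (simp add: minus_ell2_def)

lemma ell2_nth_scaleR [simp]: "ell2_nth (a *\<^sub>R x) n = a * ell2_nth x n"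
  by (simp add: scaleR_ell2_def square_summable_cmult)

instance
proof
  fix x y z :: ell2 and a b :: real
  show "x + y + z = x + (y + z)" "x + y = y + x" "0 + x = x" "- x + x = 0" "x - y = x + - y"
    by (rule ell2_eqI; simp)+
  show "a *\<^sub>R (x + y) = a *\<^sub>R x + a *\<^sub>R y" "(a + b) *\<^sub>R x = a *\<^sub>R x + b *\<^sub>R x"
    "a *\<^sub>R b *\<^sub>R x = (a * b) *\<^sub>R x" "1 *\<^sub>R x = x"
    by (rule ell2_eqI; simp add: algebra_simps)+
  show "sgn x = inverse (norm x) *\<^sub>R x"
    by (rule sgn_ell2_def)
  show "dist x y = norm (x - y)"
    by (rule dist_ell2_def)
  show "uniformity = (INF e\<in>{0<..}. principal {(x :: ell2, y). dist x y < e})"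
    by (rule uniformity_ell2_def)
  show "open U = (\<forall>x\<in>U. \<forall>\<^sub>F (x', y) in uniformity. x' = x \<longrightarrow> y \<in> U)" for U :: "ell2 set"
    by (rule open_ell2_def)
  show "x \<bullet> y = y \<bullet> x"
    by (simp add: inner_ell2_def mult.commute)
  show "(x + y) \<bullet> z = x \<bullet> z + y \<bullet> z"
    by (simp add: inner_ell2_def distrib_right suminf_add)
  show "a *\<^sub>R x \<bullet> y = a * (x \<bullet> y)"
    by (simp add: inner_ell2_def mult.assoc suminf_mult)
  show "0 \<le> x \<bullet> x"
    by (simp add: inner_ell2_def suminf_nonneg)
  show "(x \<bullet> x = 0) = (x = 0)"
  proof
    assume "x \<bullet> x = 0"
    then have "\<forall>n. ell2_nth x n * ell2_nth x n = 0"
      by (subst (asm) inner_ell2_def, subst (asm) suminf_eq_zero_iff) simp_all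
    then show "x = 0"
      by (intro ell2_eqI) simp
  qed (simp add: inner_ell2_def)
  show "norm x = sqrt (x \<bullet> x)"
    by (rule norm_ell2_def)
qed

end

section \<open>The probability simplex as a Hilbert manifold\<close>

definition prob_simplex :: "(nat \<Rightarrow> real) set" where
  "prob_simplex = {p. summable (\<lambda>n. \<bar>p n\<bar>) \<and> (\<Sum>n. p n) = 1 \<and> (\<forall>n. p n > 0)}"

definition closed_prob_simplex :: "(nat \<Rightarrow> real) set" where
  "closed_prob_simplex = {p. summable (\<lambda>n. \<bar>p n\<bar>) \<and> (\<Sum>n. p n) = 1 \<and> (\<forall>n. p n \<ge> 0)}"

definition positive_sphere :: "ell2 set" where
  "positive_sphere = {x. norm x = 1 \<and> (\<forall>n. ell2_nth x n > 0)}"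

definition sqrt_map :: "(nat \<Rightarrow> real) \<Rightarrow> ell2" where
  "sqrt_map p = Ell2 (\<lambda>n. sqrt (p n))"

definition square_map :: "ell2 \<Rightarrow> nat \<Rightarrow> real" where
  "square_map x = (\<lambda>n. (ell2_nth x n)\<^sup>2)"

text \<open>The two maps are mutually inverse bijections between \<^term>\<open>prob_simplex\<close> and
  \<^term>\<open>positive_sphere\<close>; the differentiable structure of \<^term>\<open>prob_simplex\<close> is the one transported
  along them. Thus a function on \<^term>\<open>prob_simplex\<close> is differentiated after composition with
  \<^term>\<open>square_map\<close>, and a curve in \<^term>\<open>prob_simplex\<close> after composition with \<^term>\<open>sqrt_map\<close>.\<close>

lemma closed_prob_simplex_sqrt_square_summable:
  assumes "p \<in> closed_prob_simplex"
  shows "summable (\<lambda>n. (sqrt (p n))\<^sup>2)"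
  using assms by (auto simp: closed_prob_simplex_def dest: summable_rabs_cancel)

lemma prob_simplex_subset_closed_prob_simplex: "prob_simplex \<subseteq> closed_prob_simplex"
  by (auto simp: prob_simplex_def closed_prob_simplex_def less_imp_le)

lemma bij_betw_sqrt_map: "bij_betw sqrt_map prob_simplex positive_sphere"
proof (rule bij_betw_byWitness[where f' = square_map])
  have nth: "ell2_nth (sqrt_map p) = (\<lambda>n. sqrt (p n))" if "p \<in> prob_simplex" for p
    using that prob_simplex_subset_closed_prob_simplex closed_prob_simplex_sqrt_square_summable
    unfolding sqrt_map_def by (intro ell2_nth_Ell2) blast
  show "\<forall>p\<in>prob_simplex. square_map (sqrt_map p) = p"
    by (auto simp: square_map_def nth prob_simplex_def less_imp_le)
  show "\<forall>x\<in>positive_sphere. sqrt_map (square_map x) = x"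
    by (auto simp: positive_sphere_def sqrt_map_def square_map_def less_imp_le ell2_nth_inverse)
  show "sqrt_map ` prob_simplex \<subseteq> positive_sphere"
  proof (rule image_subsetI)
    fix p assume p: "p \<in> prob_simplex"
    then have "\<And>n. sqrt (p n) * sqrt (p n) = p n"
      by (simp add: prob_simplex_def less_imp_le)
    with p show "sqrt_map p \<in> positive_sphere"
      by (auto simp: positive_sphere_def norm_ell2_def inner_ell2_def nth[OF p] prob_simplex_def)
  qed
  show "square_map ` positive_sphere \<subseteq> prob_simplex"
    by (auto simp: positive_sphere_def prob_simplex_def square_map_def norm_ell2_def inner_ell2_def
        power2_eq_square[symmetric]) (metis less_numeral_extra(3))
qed

definition tangent_space :: "(nat \<Rightarrow> real) \<Rightarrow> (nat \<Rightarrow> real) set" where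
  "tangent_space p = {v. summable (\<lambda>n. \<bar>v n\<bar>) \<and> (\<Sum>n. v n) = 0 \<and>
     summable (\<lambda>n. (v n / sqrt (p n))\<^sup>2)}"

text \<open>The differential of \<^term>\<open>sqrt_map\<close> at \<open>p\<close>, on \<^term>\<open>tangent_space p\<close>.\<close>

definition d_sqrt_map :: "(nat \<Rightarrow> real) \<Rightarrow> (nat \<Rightarrow> real) \<Rightarrow> ell2" where
  "d_sqrt_map p v = Ell2 (\<lambda>n. v n / (2 * sqrt (p n)))"

definition fisher_rao :: "(nat \<Rightarrow> real) \<Rightarrow> (nat \<Rightarrow> real) \<Rightarrow> (nat \<Rightarrow> real) \<Rightarrow> real" where
  "fisher_rao p v w = 1 / 4 * (\<Sum>n. v n * w n / p n)"

section \<open>Gradient flow lines\<close>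

text \<open>In \<open>is_gradient F p v\<close>, the linear form \<open>D \<circ> d_sqrt_map p\<close> is the differential of \<open>F\<close> at \<open>p\<close>.
  The derivative \<open>D\<close> within \<^term>\<open>positive_sphere\<close> is determined on tangent directions only, and
  these are the only ones it is applied to.\<close>

definition is_gradient :: "((nat \<Rightarrow> real) \<Rightarrow> real) \<Rightarrow> (nat \<Rightarrow> real) \<Rightarrow> (nat \<Rightarrow> real) \<Rightarrow> bool" where
  "is_gradient F p v \<longleftrightarrow> v \<in> tangent_space p \<and>
     (\<exists>D. ((\<lambda>x. F (square_map x)) has_derivative D) (at (sqrt_map p) within positive_sphere) \<and>
          (\<forall>w\<in>tangent_space p. fisher_rao p v w = D (d_sqrt_map p w)))"

definition gradient_flow_line ::
    "((nat \<Rightarrow> real) \<Rightarrow> real) \<Rightarrow> real set \<Rightarrow> (real \<Rightarrow> nat \<Rightarrow> real) \<Rightarrow> bool" where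
  "gradient_flow_line F J p \<longleftrightarrow> is_interval J \<and>
     (\<forall>t\<in>J. p t \<in> prob_simplex \<and>
        (\<exists>v. is_gradient F (p t) v \<and>
             ((\<lambda>s. sqrt_map (p s)) has_vector_derivative d_sqrt_map (p t) v) (at t within J)))"

definition linear_functional :: "ell2 \<Rightarrow> (nat \<Rightarrow> real) \<Rightarrow> real" where
  "linear_functional c p = c \<bullet> Ell2 p"

text \<open>The gradient of \<^term>\<open>linear_functional c\<close> at \<open>p\<close> is the sequence
  \<open>4 * p n * (ell2_nth c n - linear_functional c p)\<close>: the prefactor \<open>1 / 4\<close> of \<^const>\<open>fisher_rao\<close>,
  which makes \<^const>\<open>sqrt_map\<close> an isometry, turns into a factor \<open>4\<close> in the gradient. Hence the
  components of a flow line grow relative to each other like \<open>exp (4 * ell2_nth c n * t)\<close>; the rate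
  \<open>exp (ell2_nth c n * t)\<close> belongs to the metric without that prefactor.\<close>

lemma closed_prob_simplex_square_summable:
  assumes "p \<in> closed_prob_simplex"
  shows "summable (\<lambda>n. (p n)\<^sup>2)"
proof (rule summable_comparison_test'[where N = 0])
  have sp: "summable p" and nonneg: "\<And>n. p n \<ge> 0" and sum1: "(\<Sum>n. p n) = 1"
    using assms by (auto simp: closed_prob_simplex_def)
  show "summable p"
    by (fact sp)
  show "norm ((p n)\<^sup>2) \<le> p n" for n
  proof -
    have "p n \<le> 1"
      using sum_le_suminf[OF sp, of "{n}"] nonneg sum1 by simp
    then show ?thesis
      using nonneg[of n] by (simp add: power2_eq_square mult_left_le)
  qed
qed

lemma linear_functional_eq_suminf:
  "p \<in> closed_prob_simplex \<Longrightarrow> linear_functional c p = (\<Sum>n. ell2_nth c n * p n)"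
  by (simp add: linear_functional_def inner_ell2_def closed_prob_simplex_square_summable)

end

theory Submission
  imports Defs
begin

text \<open>A gradient \<open>v\<close> at \<open>p\<close> satisfies \<open>v\<^sub>i / p\<^sub>i - v\<^sub>j / p\<^sub>j = 4 (c\<^sub>i - c\<^sub>j)\<close>, so along a flow line
  \<open>ln (p\<^sub>i / p\<^sub>j)\<close> is affine in time with this slope, and normalising the sum yields the formula.
  Conversely, in the chart \<open>x\<^sub>n = sqrt p\<^sub>n\<close> the flow through \<open>x\<close> is the normalisation of the linear
  flow \<open>exp (2 c\<^sub>n t) x\<^sub>n\<close> on the Hilbert space, which is differentiable in norm because \<open>c\<close> is bounded.
  If \<open>c\<close> is strictly decreasing, the mass outside coordinate \<open>0\<close> is at most
  \<open>exp (4 (c\<^sub>1 - c\<^sub>0) t) / p\<^sub>0(0)\<close>, so the limit is the vertex \<open>(1, 0, 0, \<dots>)\<close>.\<close>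

section \<open>Coordinates and multiplication operators\<close>

lemma ell2_norm_square: "(norm x)\<^sup>2 = (\<Sum>n. (ell2_nth x n)\<^sup>2)" for x :: ell2
  by (simp only: power2_norm_eq_inner) (simp add: inner_ell2_def power2_eq_square)

lemma abs_ell2_nth_le_norm: "\<bar>ell2_nth x n\<bar> \<le> norm x"
proof -
  have "(ell2_nth x n)\<^sup>2 \<le> (norm x)\<^sup>2"
    using sum_le_suminf[of "\<lambda>n. (ell2_nth x n)\<^sup>2" "{n}"] by (simp add: ell2_norm_square)
  then show ?thesis
    by (simp add: abs_le_square_iff[symmetric])
qed

lemma bounded_linear_ell2_nth: "bounded_linear (\<lambda>x. ell2_nth x n)"
  by (rule bounded_linear_intro[where K = 1]) (simp_all add: abs_ell2_nth_le_norm)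

definition basis_vector :: "nat \<Rightarrow> ell2" where
  "basis_vector i = Ell2 (\<lambda>n. if n = i then 1 else 0)"

lemma ell2_nth_basis_vector [simp]: "ell2_nth (basis_vector i) n = (if n = i then 1 else 0)"
proof -
  have "summable (\<lambda>n. (if n = i then 1 else 0 :: real)\<^sup>2)"
    by (rule summable_finite[of "{i}"]) auto
  then show ?thesis
    by (simp add: basis_vector_def)
qed

text \<open>\<open>Ell2\<close> is meaningful only on square-summable sequences, so the facts about
  \<open>diag_op b\<close> carry a uniform bound on \<open>b\<close>, which keeps the product in
  ell^2.\<close>

definition diag_op :: "(nat \<Rightarrow> real) \<Rightarrow> ell2 \<Rightarrow> ell2" where
  "diag_op b x = Ell2 (\<lambda>n. b n * ell2_nth x n)"

lemma bounded_mult_square_summable: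
  assumes "\<And>n. \<bar>b n\<bar> \<le> B"
  shows "summable (\<lambda>n. (b n * ell2_nth x n)\<^sup>2)"
proof (rule summable_comparison_test'[where N = 0])
  show "summable (\<lambda>n. (B * ell2_nth x n)\<^sup>2)"
    by (rule square_summable_cmult) simp
  show "norm ((b n * ell2_nth x n)\<^sup>2) \<le> (B * ell2_nth x n)\<^sup>2" for n
    using assms[of n] by (auto simp: power_mult_distrib abs_le_square_iff[symmetric] intro!: mult_right_mono)
qed

lemma ell2_nth_diag_op:
  assumes "\<And>n. \<bar>b n\<bar> \<le> B"
  shows "ell2_nth (diag_op b x) n = b n * ell2_nth x n"
  using bounded_mult_square_summable[of b B x, OF assms] by (simp add: diag_op_def)

text \<open>Squares are compared termwise and summed. This serves both for the operator bound of
  \<open>diag_op\<close> and for the Taylor remainder of the linear flow.\<close>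

lemma norm_le_if_nth_le:
  fixes x y :: ell2
  assumes "\<And>n. \<bar>ell2_nth y n\<bar> \<le> B * \<bar>ell2_nth x n\<bar>" and "0 \<le> B"
  shows "norm y \<le> B * norm x"
proof -
  have "(norm y)\<^sup>2 \<le> (\<Sum>n. (B * ell2_nth x n)\<^sup>2)"
    unfolding ell2_norm_square
    using assms by (intro suminf_le square_summable_cmult)
      (simp_all add: abs_le_square_iff[symmetric] abs_mult)
  also have "\<dots> = (B * norm x)\<^sup>2"
    by (simp add: power_mult_distrib ell2_norm_square suminf_mult)
  finally show ?thesis
    using assms(2) by (simp add: power2_le_iff_abs_le)
qed

lemma bounded_linear_diag_op:
  assumes "\<And>n. \<bar>b n\<bar> \<le> B"
  shows "bounded_linear (diag_op b)"
proof (rule bounded_linear_intro[where K = B])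
  note nth = ell2_nth_diag_op[of b B, OF assms]
  show "diag_op b (x + y) = diag_op b x + diag_op b y" for x y
    by (rule ell2_eqI) (simp add: nth algebra_simps)
  show "diag_op b (r *\<^sub>R x) = r *\<^sub>R diag_op b x" for r x
    by (rule ell2_eqI) (simp add: nth)
  show "norm (diag_op b x) \<le> norm x * B" for x
  proof (subst mult.commute, rule norm_le_if_nth_le)
    show "\<bar>ell2_nth (diag_op b x) n\<bar> \<le> B * \<bar>ell2_nth x n\<bar>" for n
      using assms by (simp add: nth abs_mult mult_right_mono)
    show "0 \<le> B"
      using assms[of 0] by linarith
  qed
qed

lemma diag_op_self_adjoint:
  assumes "\<And>n. \<bar>b n\<bar> \<le> B"
  shows "x \<bullet> diag_op b y = diag_op b x \<bullet> y"
  by (simp add: inner_ell2_def ell2_nth_diag_op[of b B, OF assms] mult_ac)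

section \<open>Norm differentiability of the linear flow generated by a bounded diagonal
  operator\<close>

lemma abs_exp_remainder_le:
  fixes z :: real
  shows "\<bar>exp z - 1 - z\<bar> \<le> exp \<bar>z\<bar> * z\<^sup>2"
proof -
  \<comment> \<open>Lagrange remainder of order two: the intermediate point satisfies
    \<open>\<bar>s\<bar> \<le> \<bar>z\<bar>\<close>, and the factor 1/2 is discarded
    afterwards.\<close>
  obtain s where s: "\<bar>s\<bar> \<le> \<bar>z\<bar>" "exp z = (\<Sum>m<2. z ^ m / fact m) + exp s / fact 2 * z\<^sup>2"
    using Maclaurin_exp_le[of z 2] by auto
  have "exp z - 1 - z = exp s / 2 * z\<^sup>2"
    using s(2) by (simp add: numeral_2_eq_2)
  moreover have "exp s / 2 * z\<^sup>2 \<le> exp \<bar>z\<bar> * z\<^sup>2"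
  proof (rule mult_right_mono)
    have "exp s \<le> exp \<bar>z\<bar>" using s(1) by simp
    moreover have "exp s > 0" by simp
    ultimately show "exp s / 2 \<le> exp \<bar>z\<bar>" by linarith
  qed simp
  moreover have "0 \<le> exp s / 2 * z\<^sup>2"
    by simp
  ultimately show ?thesis
    by linarith
qed

lemma abs_exp_mult_le:
  fixes a r :: real
  assumes "\<bar>a\<bar> \<le> A"
  shows "\<bar>exp (a * r)\<bar> \<le> exp (A * \<bar>r\<bar>)"
proof -
  have "a * r \<le> \<bar>a\<bar> * \<bar>r\<bar>"
    by (metis abs_ge_self abs_mult)
  also have "\<dots> \<le> A * \<bar>r\<bar>"
    using assms by (rule mult_right_mono) simp
  finally show ?thesis
    by simp
qed

text \<open>Coordinatewise differentiability alone would not give a derivative in norm. The bound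
  \<open>A\<close> makes the second-order remainder of each coordinate at most one common constant
  times that coordinate of \<open>u t\<close>, so \<open>norm_le_if_nth_le\<close> applies.\<close>

lemma diag_exp_has_vector_derivative:
  fixes a :: "nat \<Rightarrow> real" and x :: ell2
  assumes a: "\<And>n. \<bar>a n\<bar> \<le> A"
  defines "u \<equiv> \<lambda>t. diag_op (\<lambda>n. exp (a n * t)) x"
  shows "(u has_vector_derivative diag_op a (u t)) (at t within S)"
proof -
  have u: "ell2_nth (u r) n = exp (a n * r) * ell2_nth x n" for r n
    unfolding u_def by (rule ell2_nth_diag_op) (rule abs_exp_mult_le[OF a])
  have [simp]: "ell2_nth (diag_op a y) n = a n * ell2_nth y n" for y n
    by (rule ell2_nth_diag_op) (rule a)
  have A0: "0 \<le> A"
    using a[of 0] by linarith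
  have remainder: "norm (u s - u t - (s - t) *\<^sub>R diag_op a (u t))
      \<le> exp (A * \<bar>s - t\<bar>) * A\<^sup>2 * (s - t)\<^sup>2 * norm (u t)" for s
  proof (rule norm_le_if_nth_le)
    fix n
    define z where "z = a n * (s - t)"
    have z: "\<bar>z\<bar> \<le> A * \<bar>s - t\<bar>"
      using a by (simp add: z_def abs_mult mult_right_mono)
    have "exp (a n * s) = exp z * exp (a n * t)"
      by (simp add: z_def exp_add[symmetric] algebra_simps)
    then have "ell2_nth (u s - u t - (s - t) *\<^sub>R diag_op a (u t)) n = (exp z - 1 - z) * ell2_nth (u t) n"
      by (simp add: u z_def algebra_simps)
    moreover have "\<bar>exp z - 1 - z\<bar> \<le> exp (A * \<bar>s - t\<bar>) * A\<^sup>2 * (s - t)\<^sup>2"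
    proof -
      have "z\<^sup>2 \<le> (A * \<bar>s - t\<bar>)\<^sup>2"
        using z A0 by (simp add: abs_le_square_iff[symmetric] abs_mult)
      then have "exp \<bar>z\<bar> * z\<^sup>2 \<le> exp (A * \<bar>s - t\<bar>) * (A * \<bar>s - t\<bar>)\<^sup>2"
        using z by (intro mult_mono) simp_all
      then show ?thesis
        using abs_exp_remainder_le[of z] by (simp add: power_mult_distrib mult_ac)
    qed
    ultimately show "\<bar>ell2_nth (u s - u t - (s - t) *\<^sub>R diag_op a (u t)) n\<bar>
        \<le> exp (A * \<bar>s - t\<bar>) * A\<^sup>2 * (s - t)\<^sup>2 * \<bar>ell2_nth (u t) n\<bar>"
      by (simp only: abs_mult) (rule mult_right_mono, simp_all)
  qed simp
  show ?thesis
    unfolding has_vector_derivative_def has_derivative_within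
  proof
    show "bounded_linear (\<lambda>h. h *\<^sub>R diag_op a (u t))"
      by (rule bounded_linear_scaleR_left)
    \<comment> \<open>Dividing the quadratic remainder by \<open>\<bar>s - t\<bar>\<close> leaves
      one such factor, so the majorant is continuous and vanishes at \<open>s = t\<close>.\<close>
    have "((\<lambda>s. exp (A * \<bar>s - t\<bar>) * A\<^sup>2 * \<bar>s - t\<bar> * norm (u t)) \<longlongrightarrow>
        exp (A * \<bar>t - t\<bar>) * A\<^sup>2 * \<bar>t - t\<bar> * norm (u t)) (at t within S)"
      by (intro tendsto_intros)
    then have lim: "((\<lambda>s. exp (A * \<bar>s - t\<bar>) * A\<^sup>2 * \<bar>s - t\<bar> * norm (u t)) \<longlongrightarrow> 0) (at t within S)"
      by simp
    show "((\<lambda>s. (1 / norm (s - t)) *\<^sub>R (u s - (u t + (s - t) *\<^sub>R diag_op a (u t)))) \<longlongrightarrow> 0) (at t within S)"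
    proof (rule Lim_null_comparison[OF _ lim], rule always_eventually, intro allI)
      fix s
      show "norm ((1 / norm (s - t)) *\<^sub>R (u s - (u t + (s - t) *\<^sub>R diag_op a (u t))))
          \<le> exp (A * \<bar>s - t\<bar>) * A\<^sup>2 * \<bar>s - t\<bar> * norm (u t)"
      proof (cases "s = t")
        case False
        have "norm ((1 / norm (s - t)) *\<^sub>R (u s - (u t + (s - t) *\<^sub>R diag_op a (u t))))
            = norm (u s - u t - (s - t) *\<^sub>R diag_op a (u t)) / \<bar>s - t\<bar>"
          by (simp add: diff_diff_eq)
        also have "\<dots> \<le> exp (A * \<bar>s - t\<bar>) * A\<^sup>2 * (s - t)\<^sup>2 * norm (u t) / \<bar>s - t\<bar>"
          by (rule divide_right_mono[OF remainder]) simp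
        also have "(s - t)\<^sup>2 = \<bar>s - t\<bar> * \<bar>s - t\<bar>"
          by (simp add: power2_eq_square)
        also have "exp (A * \<bar>s - t\<bar>) * A\<^sup>2 * (\<bar>s - t\<bar> * \<bar>s - t\<bar>) * norm (u t) / \<bar>s - t\<bar>
            = exp (A * \<bar>s - t\<bar>) * A\<^sup>2 * \<bar>s - t\<bar> * norm (u t)"
          using False by (simp del: abs_mult_self_eq)
        finally show ?thesis .
      qed simp
    qed
  qed
qed

section \<open>The square-root map\<close>

lemma ell2_nth_sqrt_map:
  "p \<in> prob_simplex \<Longrightarrow> ell2_nth (sqrt_map p) n = sqrt (p n)"
  using prob_simplex_subset_closed_prob_simplex closed_prob_simplex_sqrt_square_summable[of p]
  by (auto simp: sqrt_map_def)

lemma square_map_sqrt_map: "p \<in> prob_simplex \<Longrightarrow> square_map (sqrt_map p) = p"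
  by (auto simp: square_map_def ell2_nth_sqrt_map prob_simplex_def less_imp_le)

lemma sqrt_map_square_map: "x \<in> positive_sphere \<Longrightarrow> sqrt_map (square_map x) = x"
  by (auto simp: positive_sphere_def sqrt_map_def square_map_def less_imp_le ell2_nth_inverse)

lemma sqrt_map_in_positive_sphere: "p \<in> prob_simplex \<Longrightarrow> sqrt_map p \<in> positive_sphere"
  using bij_betw_sqrt_map by (auto simp: bij_betw_def)

lemma square_map_in_prob_simplex: "x \<in> positive_sphere \<Longrightarrow> square_map x \<in> prob_simplex"
  using bij_betw_sqrt_map by (force simp: bij_betw_def square_map_sqrt_map)

lemma ell2_nth_d_sqrt_map:
  assumes "v \<in> tangent_space p"
  shows "ell2_nth (d_sqrt_map p v) n = v n / (2 * sqrt (p n))"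
proof -
  have "summable (\<lambda>n. (1 / 2 * (v n / sqrt (p n)))\<^sup>2)"
    using assms by (intro square_summable_cmult) (simp add: tangent_space_def)
  then show ?thesis
    by (simp add: d_sqrt_map_def)
qed

section \<open>The gradient\<close>

text \<open>In the chart the linear objective becomes a quadratic form on the unit sphere. Its
  gradient there is the tangential part of \<open>2 *\<^sub>R diag_op (ell2_nth c) x\<close>, which
  explains why a normalised linear flow appears.\<close>

lemma linear_functional_square_map:
  assumes "x \<in> positive_sphere"
  shows "linear_functional c (square_map x) = x \<bullet> diag_op (ell2_nth c) x"
proof -
  have "square_map x \<in> closed_prob_simplex"
    using square_map_in_prob_simplex[OF assms] prob_simplex_subset_closed_prob_simplex by auto
  then show ?thesis
    by (simp add: linear_functional_eq_suminf inner_ell2_def square_map_def power2_eq_square mult_ac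
        ell2_nth_diag_op[of _ "norm c", OF abs_ell2_nth_le_norm])
qed

text \<open>The number \<open>\<mu>\<close> is the value of the objective at the point. The sphere
  gradient is twice \<open>diag_op (ell2_nth c) x - \<mu> *\<^sub>R x\<close>, and undoing
  \<open>d_sqrt_map\<close> multiplies coordinate \<open>n\<close> by
  \<open>2 * ell2_nth x n\<close>, which produces the factor 4 in \<open>v\<close>.\<close>

lemma gradient_linear_functional:
  fixes c x :: ell2
  assumes x: "x \<in> positive_sphere"
  defines "\<mu> \<equiv> x \<bullet> diag_op (ell2_nth c) x"
  defines "v \<equiv> \<lambda>n. 4 * square_map x n * (ell2_nth c n - \<mu>)"
  shows "is_gradient (linear_functional c) (square_map x) v"
    and "d_sqrt_map (square_map x) v = diag_op (\<lambda>n. 2 * ell2_nth c n) x - (2 * \<mu>) *\<^sub>R x"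
proof -
  let ?C = "diag_op (ell2_nth c)"
  note C = ell2_nth_diag_op[of "ell2_nth c" "norm c", OF abs_ell2_nth_le_norm]
  have pos: "ell2_nth x n > 0" for n
    using x by (simp add: positive_sphere_def)
  have sqrt_square: "sqrt (square_map x n) = ell2_nth x n" for n
    using pos[of n] by (simp add: square_map_def)
  \<comment> \<open>Orthogonal projection of \<open>?C x\<close> onto the tangent space of the
    sphere at \<open>x\<close>.\<close>
  define w where "w = ?C x - \<mu> *\<^sub>R x"
  have w: "ell2_nth w n = (ell2_nth c n - \<mu>) * ell2_nth x n" for n
    by (simp add: w_def C algebra_simps)
  have v: "v n = 4 * (ell2_nth x n * ell2_nth w n)" for n
    by (simp add: v_def w square_map_def power2_eq_square)
  have xx: "x \<bullet> x = 1"
    using x by (simp add: positive_sphere_def norm_eq_1)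
  have xw: "x \<bullet> w = 0"
    by (simp add: w_def inner_diff_right \<mu>_def xx)
  \<comment> \<open>\<open>v\<close> is 4 times a product of two ell^2 sequences; the inequality of
    arithmetic and geometric means gives an ell^1 majorant.\<close>
  have v_bound: "\<bar>v n\<bar> \<le> 2 * (ell2_nth x n)\<^sup>2 + 2 * (ell2_nth w n)\<^sup>2" for n
  proof -
    have "0 \<le> (\<bar>ell2_nth x n\<bar> - \<bar>ell2_nth w n\<bar>)\<^sup>2" by simp
    then have "2 * \<bar>ell2_nth x n * ell2_nth w n\<bar> \<le> (ell2_nth x n)\<^sup>2 + (ell2_nth w n)\<^sup>2"
      by (simp add: power2_diff abs_mult)
    then show ?thesis
      by (simp add: v abs_mult)
  qed
  have v_abs: "summable (\<lambda>n. \<bar>v n\<bar>)"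
  proof (rule summable_comparison_test'[where N = 0])
    show "summable (\<lambda>n. 2 * (ell2_nth x n)\<^sup>2 + 2 * (ell2_nth w n)\<^sup>2)"
      by (intro summable_mult summable_add) simp_all
  qed (simp add: v_bound)
  have v_sum: "(\<Sum>n. v n) = 0"
    using xw by (simp add: v suminf_mult inner_ell2_def)
  have v_div: "v n / sqrt (square_map x n) = 4 * ell2_nth w n" for n
    using pos[of n] by (simp add: v sqrt_square)
  have tangent: "v \<in> tangent_space (square_map x)"
    by (simp add: tangent_space_def v_div v_abs v_sum square_summable_cmult)
  have "((\<lambda>y. y \<bullet> ?C y) has_derivative (\<lambda>h. x \<bullet> ?C h + h \<bullet> ?C x)) (at x within positive_sphere)"
    using bounded_linear_diag_op[of "ell2_nth c" "norm c", OF abs_ell2_nth_le_norm]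
    by (intro has_derivative_inner has_derivative_ident bounded_linear_imp_has_derivative)
  \<comment> \<open>The quadratic form is differentiable on the whole space; the functional agrees
    with it on the sphere, so the derivative within the sphere carries over.\<close>
  then have deriv: "((\<lambda>y. linear_functional c (square_map y)) has_derivative (\<lambda>h. x \<bullet> ?C h + h \<bullet> ?C x))
      (at (sqrt_map (square_map x)) within positive_sphere)"
    unfolding sqrt_map_square_map[OF x]
    by (rule has_derivative_transform[OF x, rotated]) (simp add: linear_functional_square_map)
  have metric: "fisher_rao (square_map x) v q = x \<bullet> ?C h + h \<bullet> ?C x"
    if q: "q \<in> tangent_space (square_map x)" and h: "h = d_sqrt_map (square_map x) q" for q h
  proof -
    have q_nth: "q n = 2 * (ell2_nth x n * ell2_nth h n)" for n
      using pos[of n] by (simp add: h ell2_nth_d_sqrt_map[OF q] sqrt_square)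
    have "(\<Sum>n. q n) = 0"
      using q by (simp add: tangent_space_def)
    \<comment> \<open>Zero total mass of \<open>q\<close> means that \<open>h\<close> is orthogonal
      to \<open>x\<close>, so the summand \<open>\<mu> *\<^sub>R x\<close> of \<open>w\<close>
      disappears from the pairing below.\<close>
    then have hx: "h \<bullet> x = 0"
      by (simp add: q_nth suminf_mult inner_ell2_def mult.commute)
    have "v n * q n / square_map x n = 8 * (ell2_nth h n * ell2_nth w n)" for n
      using pos[of n] by (simp add: v q_nth square_map_def power2_eq_square)
    then have "fisher_rao (square_map x) v q = 2 * (h \<bullet> w)"
      by (simp add: fisher_rao_def suminf_mult inner_ell2_def)
    also have "\<dots> = 2 * (h \<bullet> ?C x)"
      by (simp add: w_def inner_diff_right hx)
    also have "\<dots> = x \<bullet> ?C h + h \<bullet> ?C x"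
      using diag_op_self_adjoint[of "ell2_nth c" "norm c" x h, OF abs_ell2_nth_le_norm]
      by (simp add: inner_commute)
    finally show ?thesis .
  qed
  show "is_gradient (linear_functional c) (square_map x) v"
    unfolding is_gradient_def using tangent deriv metric by blast
  have "\<bar>2 * ell2_nth c n\<bar> \<le> 2 * norm c" for n
    using abs_ell2_nth_le_norm[of c n] by simp
  note C2 = ell2_nth_diag_op[of "\<lambda>n. 2 * ell2_nth c n", OF this]
  show "d_sqrt_map (square_map x) v = diag_op (\<lambda>n. 2 * ell2_nth c n) x - (2 * \<mu>) *\<^sub>R x"
  proof (rule ell2_eqI)
    fix n
    have "ell2_nth (d_sqrt_map (square_map x) v) n = 2 * ell2_nth w n"
      using pos[of n] by (simp add: ell2_nth_d_sqrt_map[OF tangent] sqrt_square v)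
    also have "\<dots> = ell2_nth (diag_op (\<lambda>n. 2 * ell2_nth c n) x - (2 * \<mu>) *\<^sub>R x) n"
      unfolding ell2_nth_diff ell2_nth_scaleR C2 w by (simp add: algebra_simps)
    finally show "ell2_nth (d_sqrt_map (square_map x) v) n
        = ell2_nth (diag_op (\<lambda>n. 2 * ell2_nth c n) x - (2 * \<mu>) *\<^sub>R x) n" .
  qed
qed

text \<open>The differential is tested along the affine curves \<open>p + s (e\<^sub>i - e\<^sub>j)\<close>, which remain in the
  simplex for small \<open>s\<close>.\<close>

lemma gradient_linear_functional_quotients:
  assumes p: "p \<in> prob_simplex" and grad: "is_gradient (linear_functional c) p v" and ij: "i \<noteq> j"
  shows "v i / p i - v j / p j = 4 * (ell2_nth c i - ell2_nth c j)"
proof -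
  obtain D where D: "((\<lambda>x. linear_functional c (square_map x)) has_derivative D)
        (at (sqrt_map p) within positive_sphere)"
      and D_eq: "\<And>w. w \<in> tangent_space p \<Longrightarrow> fisher_rao p v w = D (d_sqrt_map p w)"
    using grad by (auto simp: is_gradient_def)
  have pos: "p n > 0" for n
    using p by (simp add: prob_simplex_def)
  \<comment> \<open>Finite support makes this direction tangent at every \<open>p\<close> and
    reduces \<open>fisher_rao\<close> to two terms.\<close>
  define w :: "nat \<Rightarrow> real" where "w n = (if n = i then 1 else if n = j then -1 else 0)" for n
  have fin: "summable f" "suminf f = f i + f j" if "\<And>n. n \<noteq> i \<Longrightarrow> n \<noteq> j \<Longrightarrow> f n = 0" for f :: "nat \<Rightarrow> real"
  proof -
    show "summable f"
      by (rule summable_finite[of "{i, j}"]) (use that in auto)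
    show "suminf f = f i + f j"
      using suminf_finite[of "{i, j}" f] that ij by auto
  qed
  have tangent: "w \<in> tangent_space p"
    by (auto simp: tangent_space_def fin w_def ij[symmetric])
  \<comment> \<open>Only coordinates \<open>i\<close> and \<open>j\<close> move, each by at most
    \<open>\<bar>s\<bar>\<close>, so this radius keeps both positive.\<close>
  define \<epsilon> where "\<epsilon> = min (p i) (p j)"
  have \<epsilon>: "\<epsilon> > 0"
    using pos by (simp add: \<epsilon>_def)
  define \<gamma> where "\<gamma> s = (\<lambda>n. p n + s * w n)" for s
  have \<gamma>: "\<gamma> s \<in> prob_simplex" if "s \<in> ball 0 \<epsilon>" for s
  proof -
    have sw: "summable (\<lambda>n. s * w n)" "(\<Sum>n. s * w n) = 0"
      using ij by (auto simp: fin w_def)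
    have sp: "summable p" "(\<Sum>n. p n) = 1"
      using p by (auto simp: prob_simplex_def dest: summable_rabs_cancel)
    have nonneg: "\<gamma> s n > 0" for n
      using that pos[of n] by (auto simp: \<gamma>_def w_def \<epsilon>_def dist_real_def)
    then have "\<bar>\<gamma> s n\<bar> = \<gamma> s n" for n
      by (simp add: less_imp_le)
    moreover have "summable (\<gamma> s)" "(\<Sum>n. \<gamma> s n) = 1"
      using summable_add[OF sp(1) sw(1)] suminf_add[OF sp(1) sw(1)] sw(2) sp(2) by (simp_all add: \<gamma>_def)
    ultimately show ?thesis
      using nonneg by (simp add: prob_simplex_def)
  qed
  \<comment> \<open>The chart image of the affine curve, written as a perturbation in two basis
    directions: its differentiability in ell^2 reduces to that of the real square root.\<close>
  define g where "g s = sqrt_map p + (sqrt (p i + s) - sqrt (p i)) *\<^sub>R basis_vector i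
      + (sqrt (p j - s) - sqrt (p j)) *\<^sub>R basis_vector j" for s
  have sqrt_\<gamma>: "sqrt_map (\<gamma> s) = g s" if "s \<in> ball 0 \<epsilon>" for s
    using ij by (intro ell2_eqI, simp add: ell2_nth_sqrt_map[OF \<gamma>[OF that]] ell2_nth_sqrt_map[OF p] g_def)
      (auto simp: \<gamma>_def w_def)
  have "(g has_vector_derivative
      (inverse (sqrt (p i)) / 2) *\<^sub>R basis_vector i - (inverse (sqrt (p j)) / 2) *\<^sub>R basis_vector j)
      (at 0 within ball 0 \<epsilon>)"
    unfolding g_def using pos[of i] pos[of j]
    by (auto intro!: derivative_eq_intros)
  also have "(inverse (sqrt (p i)) / 2) *\<^sub>R basis_vector i - (inverse (sqrt (p j)) / 2) *\<^sub>R basis_vector j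
      = d_sqrt_map p w"
    using ij by (intro ell2_eqI) (auto simp: ell2_nth_d_sqrt_map[OF tangent] w_def field_simps)
  finally have "(g has_vector_derivative d_sqrt_map p w) (at 0 within ball 0 \<epsilon>)" .
  then have dg: "(g has_derivative (\<lambda>h. h *\<^sub>R d_sqrt_map p w)) (at 0 within ball 0 \<epsilon>)"
    by (simp add: has_vector_derivative_def)
  have g0: "g 0 = sqrt_map p"
    by (simp add: g_def)
  have "g s \<in> positive_sphere" if "s \<in> ball 0 \<epsilon>" for s
    using sqrt_map_in_positive_sphere[OF \<gamma>[OF that]] by (simp only: sqrt_\<gamma>[OF that])
  then have "g ` ball 0 \<epsilon> \<subseteq> positive_sphere"
    by (rule image_subsetI)
  \<comment> \<open>\<open>D\<close> is a derivative within the sphere only; the chain rule needs it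
    on the image of the curve, which lies there.\<close>
  then have "((\<lambda>x. linear_functional c (square_map x)) has_derivative D) (at (g 0) within g ` ball 0 \<epsilon>)"
    unfolding g0 by (rule has_derivative_subset[OF D])
  from has_derivative_in_compose[OF dg this]
  have deriv: "((\<lambda>s. linear_functional c (square_map (g s))) has_derivative (\<lambda>h. D (h *\<^sub>R d_sqrt_map p w)))
      (at 0 within ball 0 \<epsilon>)" .
  have ball: "at 0 within ball 0 \<epsilon> = at 0"
    by (rule at_within_open) (simp_all add: \<epsilon>)
  from deriv have d1: "((\<lambda>s. linear_functional c (square_map (g s))) has_derivative (\<lambda>h. D (h *\<^sub>R d_sqrt_map p w))) (at 0)"
    unfolding ball by assumption
  have affine: "linear_functional c (square_map (g s)) = linear_functional c p + s * (ell2_nth c i - ell2_nth c j)"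
    if s: "s \<in> ball 0 \<epsilon>" for s
  proof -
    have "square_map (g s) = \<gamma> s"
      using sqrt_\<gamma>[OF s] square_map_sqrt_map[OF \<gamma>[OF s]] by simp
    moreover have cl: "\<gamma> s \<in> closed_prob_simplex" "p \<in> closed_prob_simplex"
      using \<gamma>[OF s] p prob_simplex_subset_closed_prob_simplex by auto
    moreover have "ell2_nth (Ell2 p) n = p n" for n
      using closed_prob_simplex_square_summable[OF cl(2)] by simp
    then have "summable (\<lambda>n. ell2_nth c n * p n)"
      using ell2_mult_summable[of c "Ell2 p"] by simp
    then have "(\<Sum>n. ell2_nth c n * \<gamma> s n) = (\<Sum>n. ell2_nth c n * p n) + (\<Sum>n. s * (ell2_nth c n * w n))"
      by (subst suminf_add) (auto simp: fin w_def \<gamma>_def algebra_simps)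
    moreover have "(\<Sum>n. s * (ell2_nth c n * w n)) = s * (ell2_nth c i - ell2_nth c j)"
      using ij by (subst fin) (auto simp: w_def algebra_simps)
    ultimately show ?thesis
      by (simp add: linear_functional_eq_suminf)
  qed
  have "((\<lambda>s. linear_functional c p + s * (ell2_nth c i - ell2_nth c j)) has_derivative
      (\<lambda>h. h * (ell2_nth c i - ell2_nth c j))) (at 0)"
    by (auto intro!: derivative_eq_intros)
  then have d2: "((\<lambda>s. linear_functional c (square_map (g s))) has_derivative
      (\<lambda>h. h * (ell2_nth c i - ell2_nth c j))) (at 0)"
    by (rule has_derivative_transform_within_open[where s = "ball 0 \<epsilon>"]) (use \<epsilon> affine in auto)
  \<comment> \<open>The two derivatives coincide because 0 is interior to the parameter interval.
    Evaluation at \<open>h = 1\<close> gives \<open>D\<close> on the chosen direction, which is all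
    that is required.\<close>
  have "D (1 *\<^sub>R d_sqrt_map p w) = 1 * (ell2_nth c i - ell2_nth c j)"
    using has_derivative_unique[OF d1 d2] by meson
  moreover have "fisher_rao p v w = 1 / 4 * (v i / p i - v j / p j)"
    using ij by (simp add: fisher_rao_def fin w_def)
  ultimately show ?thesis
    using D_eq[OF tangent] by simp
qed

section \<open>Flow lines\<close>

text \<open>If \<open>u\<close> solves u' = A u with A linear, then x = u / |u| solves x' = A x -
  <x, A x> x. For A = 2 \<open>diag_op (ell2_nth c)\<close> the right-hand side is the chart
  gradient computed in \<open>gradient_linear_functional\<close>.\<close>

lemma gradient_flow_line_exists:
  assumes p0: "p0 \<in> prob_simplex"
  shows "\<exists>p. gradient_flow_line (linear_functional c) {0..} p \<and> p 0 = p0"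
proof -
  \<comment> \<open>Rate 2 c_n for the square roots; squaring turns it into 4 c_n for the
    probabilities.\<close>
  define a where "a n = 2 * ell2_nth c n" for n
  have a: "\<bar>a n\<bar> \<le> 2 * norm c" for n
    using abs_ell2_nth_le_norm[of c n] by (simp add: a_def)
  define u where "u t = diag_op (\<lambda>n. exp (a n * t)) (sqrt_map p0)" for t
  have u_nth: "ell2_nth (u t) n = exp (a n * t) * sqrt (p0 n)" for t n
    unfolding u_def by (subst ell2_nth_diag_op, rule abs_exp_mult_le[OF a]) (simp add: ell2_nth_sqrt_map p0)
  have u_pos: "ell2_nth (u t) n > 0" for t n
    using p0 by (simp add: u_nth prob_simplex_def)
  \<comment> \<open>The norm is differentiable away from 0, and there \<open>sgn\<close> is
    normalisation to the unit sphere.\<close>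
  have u0: "u t \<noteq> 0" for t
    using u_pos[of t 0] by auto
  have x: "sgn (u t) \<in> positive_sphere" for t
    using u_pos[of t] u0[of t] by (simp add: positive_sphere_def norm_sgn) (simp add: sgn_div_norm)
  have du: "(u has_vector_derivative diag_op a (u t)) (at t within {0..})" for t
    unfolding u_def by (rule diag_exp_has_vector_derivative) (rule a)
  have "((\<lambda>s. sgn (u s)) has_vector_derivative
      diag_op a (sgn (u t)) - (sgn (u t) \<bullet> diag_op a (sgn (u t))) *\<^sub>R sgn (u t)) (at t within {0..})" for t
  proof -
    have lin: "diag_op a (r *\<^sub>R y) = r *\<^sub>R diag_op a y" for r y
      using bounded_linear_diag_op[of a, OF a] by (simp add: linear_simps)
    have n: "((\<lambda>s. norm (u s)) has_derivative (\<lambda>h. sgn (u t) \<bullet> (h *\<^sub>R diag_op a (u t)))) (at t within {0..})"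
      using has_derivative_compose[OF du[of t, unfolded has_vector_derivative_def] has_derivative_norm[OF u0[of t]]]
      by (simp add: inner_commute)
    have "((\<lambda>s. inverse (norm (u s)) *\<^sub>R u s) has_vector_derivative
       inverse (norm (u t)) *\<^sub>R diag_op a (u t) + (- (inverse (norm (u t)) * (sgn (u t) \<bullet> diag_op a (u t)) * inverse (norm (u t)))) *\<^sub>R u t)
       (at t within {0..})"
      unfolding has_vector_derivative_def
      by (rule has_derivative_eq_rhs,
          rule has_derivative_scaleR[OF Deriv.has_derivative_inverse[OF _ n] du[of t, unfolded has_vector_derivative_def]])
        (use u0[of t] in \<open>auto simp: fun_eq_iff algebra_simps\<close>)
    then show ?thesis
      by (simp add: sgn_div_norm lin divide_inverse mult_ac)
  qed
  note dx = this
  define p where "p t = square_map (sgn (u t))" for t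
  have "\<exists>v. is_gradient (linear_functional c) (p t) v \<and>
      ((\<lambda>s. sqrt_map (p s)) has_vector_derivative d_sqrt_map (p t) v) (at t within {0..})" for t
  proof -
    let ?x = "sgn (u t)" and ?\<mu> = "sgn (u t) \<bullet> diag_op (ell2_nth c) (sgn (u t))"
    have "diag_op a ?x = 2 *\<^sub>R diag_op (ell2_nth c) ?x"
      by (rule ell2_eqI) (simp add: ell2_nth_diag_op[OF a]
          ell2_nth_diag_op[of "ell2_nth c" "norm c", OF abs_ell2_nth_le_norm], simp add: a_def)
    then have "?x \<bullet> diag_op a ?x = 2 * ?\<mu>"
      by simp
    moreover have "diag_op (\<lambda>n. 2 * ell2_nth c n) = diag_op a"
      by (simp add: a_def[abs_def])
    ultimately show ?thesis
      using gradient_linear_functional[OF x[of t], of c] dx[of t]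
      unfolding p_def sqrt_map_square_map[OF x] by (intro exI conjI) (assumption, simp)
  qed
  moreover have "p t \<in> prob_simplex" for t
    by (simp add: p_def square_map_in_prob_simplex x)
  ultimately have "gradient_flow_line (linear_functional c) {0..} p"
    by (simp add: gradient_flow_line_def is_interval_ci)
  moreover have "p 0 = p0"
  proof -
    have "u 0 = sqrt_map p0"
      by (rule ell2_eqI) (simp add: u_nth ell2_nth_sqrt_map p0)
    moreover have "norm (sqrt_map p0) = 1"
      using sqrt_map_in_positive_sphere[OF p0] by (simp add: positive_sphere_def)
    ultimately show ?thesis
      by (simp add: p_def sgn_div_norm square_map_sqrt_map p0)
  qed
  ultimately show ?thesis
    by (intro exI conjI)
qed

text \<open>Conserved quantities determine the curve, so uniqueness comes with the formula.
  Convergence of \<open>Z\<close> is a conclusion: the weights turn out to be a constant multiple of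
  \<open>p t\<close>. The interval is arbitrary, so negative times are covered.\<close>

lemma gradient_flow_line_formula:
  assumes flow: "gradient_flow_line (linear_functional c) J p" and J: "0 \<in> J" "t \<in> J"
  defines "Z \<equiv> \<Sum>k. p 0 k * exp (4 * ell2_nth c k * t)"
  shows "p t n = p 0 n * exp (4 * ell2_nth c n * t) / Z" (is "p t n = ?q n / Z")
    and "summable (\<lambda>k. p 0 k * exp (4 * ell2_nth c k * t))" and "Z > 0"
proof -
  have simplex: "p s \<in> prob_simplex" if "s \<in> J" for s
    using flow that by (simp add: gradient_flow_line_def)
  have pos: "p s k > 0" if "s \<in> J" for s k
    using simplex[OF that] by (simp add: prob_simplex_def)
  have "convex J"
    using flow is_interval_convex by (auto simp: gradient_flow_line_def)
  have ratio: "p t i * ?q j = p t j * ?q i" if ij: "i \<noteq> j" for i j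
  proof -
    let ?d = "4 * (ell2_nth c i - ell2_nth c j)"
    \<comment> \<open>The conserved quantity; its derivative vanishes by
      \<open>gradient_linear_functional_quotients\<close>.\<close>
    define f where "f s = ln (p s i) - ln (p s j) - ?d * s" for s
    have df: "(f has_real_derivative 0) (at s within J)" if s: "s \<in> J" for s
    proof -
      obtain v where v: "is_gradient (linear_functional c) (p s) v"
          and y: "((\<lambda>s. sqrt_map (p s)) has_vector_derivative d_sqrt_map (p s) v) (at s within J)"
        using flow s by (auto simp: gradient_flow_line_def)
      have v_tan: "v \<in> tangent_space (p s)"
        using v by (simp add: is_gradient_def)
      \<comment> \<open>Squaring the chart coordinate recovers the probability, and the factor 2
        sqrt(p_k) cancels the denominator of \<open>d_sqrt_map\<close>.\<close>
      have dp: "((\<lambda>s. p s k) has_real_derivative v k) (at s within J)" for k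
      proof -
        have "((\<lambda>s. ell2_nth (sqrt_map (p s)) k) has_real_derivative v k / (2 * sqrt (p s k))) (at s within J)"
          using bounded_linear.has_vector_derivative[OF bounded_linear_ell2_nth y, of k]
          by (simp add: has_real_derivative_iff_has_vector_derivative ell2_nth_d_sqrt_map[OF v_tan])
        then have "((\<lambda>s. (ell2_nth (sqrt_map (p s)) k)\<^sup>2) has_real_derivative v k) (at s within J)"
          using pos[OF s, of k]
          by (auto intro!: derivative_eq_intros simp: ell2_nth_sqrt_map[OF simplex[OF s]])
        then show ?thesis
          unfolding has_field_derivative_def
          by (rule has_derivative_transform[OF s, rotated])
            (simp add: ell2_nth_sqrt_map simplex pos less_imp_le)
      qed
      have "(f has_real_derivative (v i / p s i - v j / p s j - ?d)) (at s within J)"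
        unfolding f_def using pos[OF s]
        by (auto intro!: derivative_eq_intros dp simp: divide_inverse)
      then show ?thesis
        by (simp add: gradient_linear_functional_quotients[OF simplex[OF s] v ij])
    qed
    have "f t = f 0"
      using has_field_derivative_zero_constant[OF \<open>convex J\<close> df] J by metis
    then have "ln (p t i) + ln (p 0 j) + 4 * ell2_nth c j * t = ln (p t j) + ln (p 0 i) + 4 * ell2_nth c i * t"
      by (simp add: f_def algebra_simps)
    then have "exp (ln (p t i) + ln (p 0 j) + 4 * ell2_nth c j * t) = exp (ln (p t j) + ln (p 0 i) + 4 * ell2_nth c i * t)"
      by simp
    then show ?thesis
      using pos J by (simp add: exp_add)
  qed
  have sp: "summable (p t)" "(\<Sum>k. p t k) = 1"
    using simplex[OF J(2)] by (auto simp: prob_simplex_def dest: summable_rabs_cancel)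
  have proportional: "p t i * ?q j = p t j * ?q i" for i j
    using ratio[of i j] by (cases "i = j") auto
  have q_pos: "?q k > 0" for k
    using pos[OF J(1)] by simp
  \<comment> \<open>With the index \<open>n\<close> as reference, all weights are one constant times
    \<open>p t\<close>; as \<open>p t\<close> has mass 1, that constant is \<open>Z\<close>.\<close>
  have q: "?q = (\<lambda>k. ?q n / p t n * p t k)"
    using proportional[of n] pos[OF J(2), of n] by (auto simp: fun_eq_iff field_simps)
  show summable: "summable ?q"
    by (subst q) (rule summable_mult[OF sp(1)])
  have Z: "Z = ?q n / p t n"
    unfolding Z_def by (subst q, subst suminf_mult[OF sp(1)]) (simp add: sp(2))
  show "Z > 0"
    unfolding Z using q_pos[of n] pos[OF J(2), of n] by simp
  show "p t n = ?q n / Z"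
    unfolding Z using pos[OF J(1), of n] pos[OF J(2), of n] by simp
qed

section \<open>Long-time limit and the linear program\<close>

lemma gradient_flow_line_limit:
  assumes flow: "gradient_flow_line (linear_functional c) J p" and J: "{0..} \<subseteq> J"
    and c: "strict_antimono_on UNIV (ell2_nth c)"
  defines "e \<equiv> \<lambda>n::nat. if n = 0 then 1 else 0 :: real"
  shows "((\<lambda>t. \<Sum>n. \<bar>p t n - e n\<bar>) \<longlongrightarrow> 0) at_top"
proof -
  have J0: "0 \<in> J"
    using J by auto
  have simplex: "p s \<in> prob_simplex" if "s \<ge> 0" for s
    using flow J that by (auto simp: gradient_flow_line_def)
  have pos: "p s k > 0" if "s \<ge> 0" for s k
    using simplex[OF that] by (simp add: prob_simplex_def)
  have sp: "summable (p t)" "(\<Sum>k. p t k) = 1" if "t \<ge> 0" for t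
    using simplex[OF that] by (auto simp: prob_simplex_def dest: summable_rabs_cancel)
  let ?d = "ell2_nth c 1 - ell2_nth c 0"
  have d: "?d < 0"
    using c by (simp add: monotone_on_def)
  \<comment> \<open>Every rate outside coordinate 0 is at most \<open>ell2_nth c 1\<close>, so the
    single gap \<open>?d\<close> controls the whole tail uniformly.\<close>
  have c1: "ell2_nth c (Suc n) \<le> ell2_nth c 1" for n
    using c by (cases n) (auto simp: monotone_on_def less_imp_le)
  have tail_bound: "(\<Sum>n. p t (Suc n)) \<le> exp (4 * ?d * t) / p 0 0" if t: "t \<ge> 0" for t
  proof -
    have tJ: "t \<in> J"
      using J t by auto
    define Z where "Z = (\<Sum>k. p 0 k * exp (4 * ell2_nth c k * t))"
    note formula = gradient_flow_line_formula[OF flow J0 tJ, folded Z_def]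
    \<comment> \<open>Keeping only the term of index 0 bounds the normaliser from below by the
      fastest growing weight.\<close>
    have "p 0 0 * exp (4 * ell2_nth c 0 * t) \<le> Z"
      using sum_le_suminf[OF formula(2), of "{0}"] pos[of 0] by (simp add: Z_def less_imp_le)
    then have Z_inv: "1 / Z \<le> 1 / (p 0 0 * exp (4 * ell2_nth c 0 * t))"
      using pos[of 0 0] by (intro divide_left_mono) (simp_all add: formula(3))
    have "p t (Suc n) \<le> exp (4 * ?d * t) / p 0 0 * p 0 (Suc n)" for n
    proof -
      have "p t (Suc n) = p 0 (Suc n) * exp (4 * ell2_nth c (Suc n) * t) * (1 / Z)"
        using formula(1)[of "Suc n"] by simp
      also have "\<dots> \<le> p 0 (Suc n) * exp (4 * ell2_nth c 1 * t) * (1 / (p 0 0 * exp (4 * ell2_nth c 0 * t)))"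
        using pos[of 0] Z_inv formula(3) t c1[of n]
        by (intro mult_mono mult_left_mono) (simp_all add: less_imp_le mult_right_mono)
      also have "\<dots> = exp (4 * ?d * t) / p 0 0 * p 0 (Suc n)"
        by (simp add: exp_diff left_diff_distrib right_diff_distrib mult_ac)
      finally show ?thesis .
    qed
    then have "(\<Sum>n. p t (Suc n)) \<le> (\<Sum>n. exp (4 * ?d * t) / p 0 0 * p 0 (Suc n))"
      using sp[OF t] sp[of 0] by (intro suminf_le summable_mult) (simp_all add: summable_Suc_iff)
    \<comment> \<open>The initial mass outside coordinate 0 is at most 1, which gives the final
      bound.\<close>
    also have "\<dots> = exp (4 * ?d * t) / p 0 0 * (1 - p 0 0)"
      using sp[of 0] by (subst suminf_mult) (simp_all add: summable_Suc_iff suminf_split_head)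
    also have "\<dots> \<le> exp (4 * ?d * t) / p 0 0"
      using pos[of 0 0] by (simp add: mult_le_cancel_left2 divide_le_cancel)
    finally show ?thesis .
  qed
  \<comment> \<open>The mass missing at coordinate 0 equals the mass of the tail, so it enters the
    ell^1 distance to the vertex twice.\<close>
  have l1: "(\<Sum>n. \<bar>p t n - e n\<bar>) = 2 * (\<Sum>n. p t (Suc n))" if t: "t \<ge> 0" for t
  proof -
    have tail: "\<bar>p t (Suc n) - e (Suc n)\<bar> = p t (Suc n)" for n
      using pos[OF t, of "Suc n"] by (simp add: e_def)
    have sh: "(\<Sum>n. p t (Suc n)) = 1 - p t 0"
      using sp[OF t] by (simp add: suminf_split_head)
    have "summable (\<lambda>n. \<bar>p t (Suc n) - e (Suc n)\<bar>)"
      unfolding tail using sp(1)[OF t] by (simp add: summable_Suc_iff)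
    then have "summable (\<lambda>n. \<bar>p t n - e n\<bar>)"
      by (subst (asm) summable_Suc_iff)
    from suminf_split_head[OF this]
    have "(\<Sum>n. \<bar>p t n - e n\<bar>) = (\<Sum>n. p t (Suc n)) + \<bar>p t 0 - 1\<bar>"
      by (simp add: tail) (simp add: e_def)
    moreover have "0 \<le> (\<Sum>n. p t (Suc n))"
      using sp(1)[OF t] pos[OF t] by (intro suminf_nonneg) (simp_all add: summable_Suc_iff less_imp_le)
    ultimately show ?thesis
      using sh by simp
  qed
  have "((\<lambda>t. exp (4 * ?d * t)) \<longlongrightarrow> 0) at_top"
    using d by (intro filterlim_compose[OF exp_at_bot] filterlim_tendsto_neg_mult_at_bot[OF tendsto_const])
      (simp_all add: filterlim_ident)
  then have "((\<lambda>t. 2 * (exp (4 * ?d * t) / p 0 0)) \<longlongrightarrow> 2 * (0 / p 0 0)) at_top"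
    using pos[of 0 0] by (intro tendsto_intros) simp_all
  then have lim: "((\<lambda>t. 2 * (exp (4 * ?d * t) / p 0 0)) \<longlongrightarrow> 0) at_top"
    by simp
  show ?thesis
  proof (rule Lim_null_comparison[OF _ lim])
    show "\<forall>\<^sub>F t in at_top. norm (\<Sum>n. \<bar>p t n - e n\<bar>) \<le> 2 * (exp (4 * ?d * t) / p 0 0)"
      using eventually_ge_at_top[of 0]
    proof eventually_elim
      case (elim t)
      have "0 \<le> (\<Sum>n. p t (Suc n))"
        using sp(1)[OF elim] pos[OF elim] by (intro suminf_nonneg) (simp_all add: summable_Suc_iff less_imp_le)
      then show ?case
        using tail_bound[OF elim] by (simp add: l1[OF elim])
    qed
  qed
qed

text \<open>On the closed simplex the objective is a weighted average of the c_n, hence at most c_0,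
  and the vertex attains this value.\<close>

lemma linear_functional_arg_max:
  assumes c: "strict_antimono_on UNIV (ell2_nth c)"
  defines "e \<equiv> \<lambda>n::nat. if n = 0 then 1 else 0 :: real"
  shows "e \<in> closed_prob_simplex"
    and "is_arg_max (linear_functional c) (\<lambda>q. q \<in> closed_prob_simplex) e"
proof -
  have fin: "summable f" "suminf f = f 0" if "\<And>n. n \<noteq> 0 \<Longrightarrow> f n = 0" for f :: "nat \<Rightarrow> real"
    using that summable_finite[of "{0}" f] suminf_finite[of "{0}" f] by auto
  show e: "e \<in> closed_prob_simplex"
    by (auto simp: closed_prob_simplex_def e_def fin)
  have "linear_functional c q \<le> linear_functional c e" if q: "q \<in> closed_prob_simplex" for q
  proof -
    have sq: "summable q" "(\<Sum>n. q n) = 1" "\<And>n. q n \<ge> 0"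
      using q by (auto simp: closed_prob_simplex_def)
    have "ell2_nth c n \<le> ell2_nth c 0" for n
      using c by (cases "n = 0") (auto simp: monotone_on_def less_imp_le)
    moreover have "summable (\<lambda>n. ell2_nth c n * q n)"
      using ell2_mult_summable[of c "Ell2 q"] closed_prob_simplex_square_summable[OF q] by simp
    ultimately have "(\<Sum>n. ell2_nth c n * q n) \<le> (\<Sum>n. ell2_nth c 0 * q n)"
      using sq by (intro suminf_le summable_mult) (simp_all add: mult_right_mono)
    also have "\<dots> = (\<Sum>n. ell2_nth c n * e n)"
      using sq by (simp add: suminf_mult) (simp add: fin e_def)
    finally show ?thesis
      using q e by (simp add: linear_functional_eq_suminf)
  qed
  then show "is_arg_max (linear_functional c) (\<lambda>q. q \<in> closed_prob_simplex) e"
    using e by (auto simp: is_arg_max_def not_less)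
qed

text \<open>The existence conjunct shows that the universal statement is not vacuous. The rate is 4
  c_n rather than the c_n of the informal formula, because the prefactor 1/4 of
  \<open>fisher_rao\<close> is kept. The limit is taken in the ell^1 norm.\<close>

theorem proposition1:
  fixes c :: ell2 and p0 :: "nat \<Rightarrow> real"
  assumes "p0 \<in> prob_simplex"
  shows "(\<exists>p. gradient_flow_line (linear_functional c) {0..} p \<and> p 0 = p0) \<and>
    (\<forall>J p. gradient_flow_line (linear_functional c) J p \<and> 0 \<in> J \<and> p 0 = p0 \<longrightarrow>
      (\<forall>n. \<forall>t\<in>J. t \<ge> 0 \<longrightarrow>
        p t n = p 0 n * exp (4 * ell2_nth c n * t) / (\<Sum>k. p 0 k * exp (4 * ell2_nth c k * t))) \<and>
      ({0..} \<subseteq> J \<and> strict_antimono_on UNIV (ell2_nth c) \<longrightarrow>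
        (\<exists>p_max\<in>closed_prob_simplex.
          ((\<lambda>t. \<Sum>n. \<bar>p t n - p_max n\<bar>) \<longlongrightarrow> 0) at_top \<and>
          is_arg_max (linear_functional c) (\<lambda>q. q \<in> closed_prob_simplex) p_max)))"
proof (intro conjI allI impI ballI)
  show "\<exists>p. gradient_flow_line (linear_functional c) {0..} p \<and> p 0 = p0"
    by (rule gradient_flow_line_exists[OF assms])
next
  fix J p n t
  assume "gradient_flow_line (linear_functional c) J p \<and> 0 \<in> J \<and> p 0 = p0" "t \<in> J"
  then show "p t n = p 0 n * exp (4 * ell2_nth c n * t) / (\<Sum>k. p 0 k * exp (4 * ell2_nth c k * t))"
    by (intro gradient_flow_line_formula(1)) auto
next
  fix J p
  assume flow: "gradient_flow_line (linear_functional c) J p \<and> 0 \<in> J \<and> p 0 = p0"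
    and c: "{0..} \<subseteq> J \<and> strict_antimono_on UNIV (ell2_nth c)"
  show "\<exists>p_max\<in>closed_prob_simplex.
      ((\<lambda>t. \<Sum>n. \<bar>p t n - p_max n\<bar>) \<longlongrightarrow> 0) at_top \<and>
      is_arg_max (linear_functional c) (\<lambda>q. q \<in> closed_prob_simplex) p_max"
    using gradient_flow_line_limit[of c J p] linear_functional_arg_max[of c] flow c
    by (intro bexI[of _ "\<lambda>n. if n = 0 then 1 else 0"]) simp_all
qed

end
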